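(* Let $\|\cdot\|$ be a norm on $\mathbb{R}^d$ with associated sequence $\{\|\cdot\|^{\star\mathrm{sn}}_{\star,(j)}\}_{j\in\{1,\ldots,d\}}$ of generalized $k$-support dual norms. Suppose that both the norm $\|\cdot\|$ and the dual norm $\|\cdot\|_\star$ are orthant-strictly monotonic. Let $\varphi:\{0,1,\ldots,d\}\to\mathbb{R}_+$ be a nonnegative nondecreasing function such that $\varphi(0)=0$. Then, for all $x\in\mathbb{R}^d\setminus\{0\}$, $$\varphi\big(\ell_0(x)\big)=\frac{1}{\|x\|}\min_{\substack{x^{(1)}\in\mathbb{R}^d,\ldots,x^{(d)}\in\mathbb{R}^d\\ \sum_{j=1}^d\|x^{(j)}\|^{\star\mathrm{sn}}_{\star,(j)}\le\|x\|\\ \sum_{j=1}^dx^{(j)}=x}}\ \sum_{j=1}^d\varphi(j)\,\|x^{(j)}\|^{\star\mathrm{sn}}_{\star,(j)}.$$ Moreover, when $\ell_0(x)=l\ge1$, the minimum is achieved at $(x^{(1)},\ldots,x^{(d)})\in(\mathbb{R}^d)^d$ such that $x^{(j)}=0$ for $j\ne l$ and $x^{(l)}=x$.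
   Context: $\mathbb{R}^d$ ($d\ge1$) is equipped with the scalar product $\langle\cdot,\cdot\rangle$ (the source norm $\|\cdot\|$ need not be Euclidean). $\ell_0(x)$ is the number of nonzero components of $x\in\mathbb{R}^d$. The dual norm is $\|y\|_\star=\sup_{\|x\|\le1}\langle x,y\rangle$. A norm $N$ on $\mathbb{R}^d$ is orthant-strictly monotonic if, for all $x,x'\in\mathbb{R}^d$ with $|x_i|\le|x'_i|$ for all $i$, $|x_j|<|x'_j|$ for some $j$, and $x_ix'_i\ge0$ for all $i$, one has $N(x)<N(x')$. For $k\in\{1,\ldots,d\}$, the generalized top-$k$ dual norm is $\|y\|^{\mathrm{tn}}_{\star,(k)}=\sup_{K\subset\{1,\ldots,d\},\,|K|\le k}\|y_K\|_\star$, where $y_K\in\mathbb{R}^d$ coincides with $y$ on $K$ and vanishes outside $K$; the generalized $k$-support dual norm $\|\cdot\|^{\star\mathrm{sn}}_{\star,(k)}$ is its dual norm, $\|x\|^{\star\mathrm{sn}}_{\star,(k)}=\sup\{\langle x,y\rangle:\|y\|^{\mathrm{tn}}_{\star,(k)}\le1\}$. *)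

theory Defs
  imports "HOL-Analysis.Analysis"
begin

definition is_norm :: "(real ^ 'n \<Rightarrow> real) \<Rightarrow> bool" where
  "is_norm N \<longleftrightarrow>
     (\<forall>x. 0 \<le> N x) \<and> (\<forall>x. N x = 0 \<longleftrightarrow> x = 0) \<and>
     (\<forall>c x. N (c *\<^sub>R x) = \<bar>c\<bar> * N x) \<and> (\<forall>x y. N (x + y) \<le> N x + N y)"

definition dual_norm :: "(real ^ 'n \<Rightarrow> real) \<Rightarrow> real ^ 'n \<Rightarrow> real" where
  "dual_norm N y = (SUP x\<in>{x. N x \<le> 1}. x \<bullet> y)"

definition orthant_strictly_monotonic :: "(real ^ 'n \<Rightarrow> real) \<Rightarrow> bool" where
  "orthant_strictly_monotonic N \<longleftrightarrow>
     (\<forall>x x'. (\<forall>i. \<bar>x $ i\<bar> \<le> \<bar>x' $ i\<bar>) \<and> (\<exists>j. \<bar>x $ j\<bar> < \<bar>x' $ j\<bar>) \<and> (\<forall>i. x $ i * x' $ i \<ge> 0)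
        \<longrightarrow> N x < N x')"

definition l0 :: "real ^ 'n \<Rightarrow> nat" where
  "l0 x = card {i. x $ i \<noteq> 0}"

definition restrict_vec :: "'n set \<Rightarrow> real ^ 'n \<Rightarrow> real ^ 'n" where
  "restrict_vec K y = (\<chi> i. if i \<in> K then y $ i else 0)"

text \<open>In the next two definitions \<open>N\<close> is the source norm; its dual norm is taken inside.\<close>

definition top_k_dual_norm :: "(real ^ 'n \<Rightarrow> real) \<Rightarrow> nat \<Rightarrow> real ^ 'n \<Rightarrow> real" where
  "top_k_dual_norm N k y = (SUP K\<in>{K. card K \<le> k}. dual_norm N (restrict_vec K y))"

definition k_support_dual_norm :: "(real ^ 'n \<Rightarrow> real) \<Rightarrow> nat \<Rightarrow> real ^ 'n \<Rightarrow> real" where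
  "k_support_dual_norm N k = dual_norm (top_k_dual_norm N k)"

text \<open>A \<open>d\<close>-tuple of vectors, \<open>d = CARD('n)\<close>, is a function on \<open>nat\<close> of which only the
  values on \<open>{1..d}\<close> are used.\<close>

definition feasible :: "(real ^ 'n \<Rightarrow> real) \<Rightarrow> real ^ 'n \<Rightarrow> (nat \<Rightarrow> real ^ 'n) \<Rightarrow> bool" where
  "feasible N x X \<longleftrightarrow>
     (\<Sum>j=1..CARD('n). k_support_dual_norm N j (X j)) \<le> N x \<and> (\<Sum>j=1..CARD('n). X j) = x"

definition objective ::
    "(real ^ 'n \<Rightarrow> real) \<Rightarrow> (nat \<Rightarrow> real) \<Rightarrow> (nat \<Rightarrow> real ^ 'n) \<Rightarrow> real" where
  "objective N \<phi> X = (\<Sum>j=1..CARD('n). \<phi> j * k_support_dual_norm N j (X j))"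

end

theory Submission imports Defs begin

text \<open>
  Write \<open>M\<close> for the dual norm of \<open>N\<close>, \<open>T\<^sub>j\<close> for the generalized top-\<open>j\<close> dual norm,
  \<open>S\<^sub>j\<close> for its dual norm and \<open>l\<close> for \<open>l0 x\<close>.

  Upper bound: since \<open>x\<close> lives on \<open>l\<close> coordinates, pairing \<open>x\<close> with \<open>y\<close> only sees the
  restriction of \<open>y\<close> to them, so \<open>x \<bullet> y \<le> N x * T\<^sub>l y\<close> and \<open>S\<^sub>l x \<le> N x\<close>
  (\<open>k_support_dual_norm_sparse_le\<close>).  Hence placing all of \<open>x\<close> at index \<open>l\<close> is feasible, at
  a cost of at most \<open>\<phi> l * N x\<close>.

  Lower bound: the key is a dual vector \<open>y\<close> that norms \<open>x\<close>, that is \<open>M y \<le> 1\<close> and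
  \<open>x \<bullet> y = N x\<close>.  Strict monotonicity of \<open>N\<close> forces \<open>y\<close> to be nonzero wherever \<open>x\<close> is
  (\<open>norming_vector_support\<close>).  So keeping fewer than \<open>l\<close> coordinates of \<open>y\<close> loses a nonzero
  one, and strict monotonicity of \<open>M\<close> gives \<open>T\<^sub>j y < 1\<close> for \<open>j < l\<close>, whereas \<open>T\<^sub>j y \<le> 1\<close>
  always.  For a feasible \<open>X\<close>,
  \<open>N x = (\<Sum>j. X j \<bullet> y) \<le> (\<Sum>j. T\<^sub>j y * S\<^sub>j (X j)) \<le> (\<Sum>j. S\<^sub>j (X j)) \<le> N x\<close>,
  so all these are equalities and \<open>S\<^sub>j (X j) = 0\<close> for \<open>j < l\<close>
  (\<open>feasible_concentrated\<close>).  All the mass \<open>N x\<close> thus sits at indices \<open>j \<ge> l\<close>,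
  where the unit price \<open>\<phi> j\<close> is at least \<open>\<phi> l\<close>.
\<close>

section \<open>Norms on a finite-dimensional space and their duals\<close>

lemma is_normD:
  assumes "is_norm N"
  shows "0 \<le> N x" and "N x = 0 \<longleftrightarrow> x = 0" and "N (c *\<^sub>R x) = \<bar>c\<bar> * N x"
    and "N (x + y) \<le> N x + N y" and "N 0 = 0"
  using assms unfolding is_norm_def by auto

lemma is_norm_pos: "is_norm N \<Longrightarrow> x \<noteq> 0 \<Longrightarrow> 0 < N x"
  using is_normD(1,2)[of N x] by linarith

lemma is_norm_convex_on:
  assumes "is_norm N"
  shows "convex_on UNIV N"
proof (rule convex_onI)
  fix t :: real and x y
  assume "0 < t" "t < 1"
  then show "N ((1 - t) *\<^sub>R x + t *\<^sub>R y) \<le> (1 - t) * N x + t * N y"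
    using is_normD(4)[OF assms, of "(1 - t) *\<^sub>R x" "t *\<^sub>R y"] by (simp add: is_normD(3)[OF assms])
qed simp

text \<open>Domination of the Euclidean norm, by compactness of the Euclidean sphere: \<open>N\<close> is
  continuous because it is convex.  It makes the supremum defining a dual norm finite.\<close>

lemma norm_le_is_norm:
  fixes N :: "real ^ 'n \<Rightarrow> real"
  assumes N: "is_norm N"
  obtains c where "0 < c" and "\<And>x. norm x \<le> c * N x"
proof -
  have cont: "continuous_on UNIV N"
    by (rule convex_on_continuous) (auto simp: is_norm_convex_on[OF N])
  obtain a :: "real ^ 'n" where a: "a \<in> sphere 0 1" "\<And>y. y \<in> sphere 0 1 \<Longrightarrow> N a \<le> N y"
    using continuous_attains_inf[of "sphere 0 1" N] continuous_on_subset[OF cont] by auto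
  then have pos: "0 < N a"
    using is_norm_pos[OF N, of a] by fastforce
  have "norm x \<le> inverse (N a) * N x" for x
  proof (cases "x = 0")
    case False
    then have "N a \<le> N (inverse (norm x) *\<^sub>R x)"
      by (intro a(2)) simp
    then show ?thesis
      using False pos by (simp add: is_normD(3)[OF N] field_simps)
  qed (simp add: is_normD(5)[OF N])
  with pos that show thesis
    by (metis inverse_positive_iff_positive)
qed

lemma dual_norm_upper:
  fixes N :: "real ^ 'n \<Rightarrow> real"
  assumes N: "is_norm N" and "N x \<le> 1"
  shows "x \<bullet> y \<le> dual_norm N y"
proof -
  obtain c where c: "0 < c" "\<And>x. norm x \<le> c * N x"
    using norm_le_is_norm[OF N] by blast
  have "z \<bullet> y \<le> c * norm y" if "N z \<le> 1" for z
  proof -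
    have "norm z \<le> c"
      using c(2)[of z] mult_left_mono[OF that, of c] c(1) by linarith
    then show ?thesis
      using norm_cauchy_schwarz[of z y] mult_right_mono[of "norm z" c "norm y"] by simp
  qed
  then have "bdd_above ((\<lambda>x. x \<bullet> y) ` {x. N x \<le> 1})"
    by (intro bdd_aboveI2[of _ _ "c * norm y"]) auto
  then show ?thesis
    unfolding dual_norm_def using assms(2) by (intro cSUP_upper) auto
qed

lemma dual_norm_le:
  assumes "is_norm N" and "\<And>x. N x \<le> 1 \<Longrightarrow> x \<bullet> y \<le> b"
  shows "dual_norm N y \<le> b"
  unfolding dual_norm_def
proof (rule cSUP_least)
  have "0 \<in> {x. N x \<le> 1}"
    by (simp add: is_normD(5)[OF assms(1)])
  then show "{x. N x \<le> 1} \<noteq> {}"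
    by blast
qed (use assms(2) in simp)

lemma dual_norm_nonneg:
  assumes "is_norm N"
  shows "0 \<le> dual_norm N y"
  using dual_norm_upper[OF assms, of 0 y] is_normD(5)[OF assms] by simp

lemma dual_norm_zero:
  assumes "is_norm N"
  shows "dual_norm N 0 = 0"
  using dual_norm_le[OF assms, of 0 0] dual_norm_nonneg[OF assms, of 0] by simp

lemma inner_le_norm_dual_norm:
  assumes N: "is_norm N"
  shows "x \<bullet> y \<le> N x * dual_norm N y"
proof (cases "x = 0")
  case False
  then have pos: "0 < N x"
    by (rule is_norm_pos[OF N])
  have "(inverse (N x) *\<^sub>R x) \<bullet> y \<le> dual_norm N y"
    using pos by (intro dual_norm_upper[OF N]) (simp add: is_normD(3)[OF N])
  with pos show ?thesis
    by (simp add: field_simps)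
qed (simp add: is_normD(5)[OF N])

lemma is_norm_dual_norm:
  assumes N: "is_norm N"
  shows "is_norm (dual_norm N)"
proof -
  have definite: "y = 0" if "dual_norm N y = 0" for y
    using inner_le_norm_dual_norm[OF N, of y y] inner_gt_zero_iff[of y] unfolding that by linarith
  have scale_le: "dual_norm N (c *\<^sub>R y) \<le> \<bar>c\<bar> * dual_norm N y" for c y
  proof (rule dual_norm_le[OF N])
    fix x assume "N x \<le> 1"
    have "x \<bullet> (c *\<^sub>R y) \<le> N (c *\<^sub>R x) * dual_norm N y"
      using inner_le_norm_dual_norm[OF N, of "c *\<^sub>R x" y] by simp
    also have "\<dots> \<le> \<bar>c\<bar> * dual_norm N y"
      using \<open>N x \<le> 1\<close> dual_norm_nonneg[OF N]
      by (intro mult_right_mono) (auto simp: is_normD(3)[OF N] mult_left_le)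
    finally show "x \<bullet> (c *\<^sub>R y) \<le> \<bar>c\<bar> * dual_norm N y" .
  qed
  have scale: "dual_norm N (c *\<^sub>R y) = \<bar>c\<bar> * dual_norm N y" for c y
  proof (cases "c = 0")
    case False
    \<comment> \<open>the reverse inequality is the same one for the factor \<open>inverse c\<close>\<close>
    have "dual_norm N y \<le> \<bar>inverse c\<bar> * dual_norm N (c *\<^sub>R y)"
      using scale_le[of "inverse c" "c *\<^sub>R y"] False by simp
    then have "\<bar>c\<bar> * dual_norm N y \<le> dual_norm N (c *\<^sub>R y)"
      using False by (simp add: field_simps)
    with scale_le[of c y] show ?thesis by simp
  qed (simp add: dual_norm_zero[OF N])
  have triangle: "dual_norm N (y + z) \<le> dual_norm N y + dual_norm N z" for y z
    by (rule dual_norm_le[OF N]) (auto simp: inner_add_right intro!: add_mono dual_norm_upper[OF N])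
  show ?thesis
    unfolding is_norm_def
    using definite scale triangle dual_norm_nonneg[OF N] dual_norm_zero[OF N] by blast
qed

text \<open>A functional separating the point \<open>x / N x\<close> from the open unit ball, rescaled to take the
  value \<open>1\<close> at that point.\<close>

lemma ex_norming_vector:
  assumes N: "is_norm N" and "x \<noteq> 0"
  obtains y where "dual_norm N y \<le> 1" and "x \<bullet> y = N x"
proof -
  have pos: "0 < N x"
    using is_norm_pos[OF N \<open>x \<noteq> 0\<close>] .
  define u where "u = inverse (N x) *\<^sub>R x"
  have "N u = 1"
    using pos by (simp add: u_def is_normD(3)[OF N])
  have "convex {z. N z < 1}"
  proof (rule convexI)
    fix z w and s t :: real
    assume zw: "z \<in> {z. N z < 1}" "w \<in> {z. N z < 1}" and st: "0 \<le> s" "0 \<le> t" "s + t = 1"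
    have "N (s *\<^sub>R z + t *\<^sub>R w) \<le> s * N z + t * N w"
      using is_normD(4)[OF N, of "s *\<^sub>R z" "t *\<^sub>R w"] st by (simp add: is_normD(3)[OF N])
    also have "\<dots> < 1"
      using zw st by (intro convex_bound_lt) auto
    finally show "s *\<^sub>R z + t *\<^sub>R w \<in> {z. N z < 1}" by simp
  qed
  moreover have "0 \<in> {z. N z < 1}"
    by (simp add: is_normD(5)[OF N])
  ultimately obtain a b where "a \<noteq> 0" and sep: "\<And>z. N z < 1 \<Longrightarrow> a \<bullet> z \<le> b" "b \<le> a \<bullet> u"
    using separating_hyperplane_sets[of "{z. N z < 1}" "{u}"] \<open>N u = 1\<close> by auto
  have bound: "a \<bullet> z \<le> a \<bullet> u" if "N z \<le> 1" for z
  proof (rule field_le_mult_one_interval)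
    fix t :: real assume t: "0 < t" "t < 1"
    then have "t * N z \<le> t * 1"
      using that by (intro mult_left_mono) auto
    then have "N (t *\<^sub>R z) < 1"
      unfolding is_normD(3)[OF N] using t by linarith
    then show "t * (a \<bullet> z) \<le> a \<bullet> u"
      using sep(1)[of "t *\<^sub>R z"] sep(2) by simp
  qed
  have "0 < N a"
    using is_norm_pos[OF N \<open>a \<noteq> 0\<close>] .
  then have "inverse (N a) * (a \<bullet> a) \<le> a \<bullet> u"
    using bound[of "inverse (N a) *\<^sub>R a"] by (simp add: is_normD(3)[OF N])
  moreover have "0 < inverse (N a) * (a \<bullet> a)"
    using \<open>0 < N a\<close> \<open>a \<noteq> 0\<close> by simp
  ultimately have "0 < a \<bullet> u" by simp
  show thesis
  proof (rule that)
    show "dual_norm N (inverse (a \<bullet> u) *\<^sub>R a) \<le> 1"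
      using bound \<open>0 < a \<bullet> u\<close>
      by (intro dual_norm_le[OF N]) (simp add: inner_commute field_simps)
    have "x = N x *\<^sub>R u"
      using pos by (simp add: u_def)
    then have "a \<bullet> x = N x * (a \<bullet> u)"
      by (metis inner_scaleR_right)
    then show "x \<bullet> (inverse (a \<bullet> u) *\<^sub>R a) = N x"
      using \<open>0 < a \<bullet> u\<close> by (simp add: inner_commute)
  qed
qed

section \<open>Restriction to a set of coordinates\<close>

lemma restrict_vec_linear:
  "restrict_vec K (x + y) = restrict_vec K x + restrict_vec K y"
  "restrict_vec K (c *\<^sub>R x) = c *\<^sub>R restrict_vec K x"
  by (auto simp: restrict_vec_def vec_eq_iff)

lemma inner_restrict_vec: "restrict_vec K x \<bullet> y = x \<bullet> restrict_vec K y"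
  by (auto simp: restrict_vec_def inner_vec_def intro!: sum.cong)

lemma restrict_vec_eq_self: "restrict_vec K x = x \<longleftrightarrow> (\<forall>i. x $ i \<noteq> 0 \<longrightarrow> i \<in> K)"
  by (auto simp: restrict_vec_def vec_eq_iff)

lemma orthant_strictly_monotonic_restrict_less:
  assumes "orthant_strictly_monotonic N" and "y $ j \<noteq> 0" and "j \<notin> K"
  shows "N (restrict_vec K y) < N y"
proof -
  have "\<forall>i. \<bar>restrict_vec K y $ i\<bar> \<le> \<bar>y $ i\<bar>" "\<bar>restrict_vec K y $ j\<bar> < \<bar>y $ j\<bar>"
    "\<forall>i. restrict_vec K y $ i * y $ i \<ge> 0"
    using assms(2,3) by (auto simp: restrict_vec_def)
  then show ?thesis
    using assms(1) unfolding orthant_strictly_monotonic_def by blast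
qed

lemma orthant_strictly_monotonic_restrict_le:
  assumes "orthant_strictly_monotonic N"
  shows "N (restrict_vec K y) \<le> N y"
proof (cases "restrict_vec K y = y")
  case False
  then show ?thesis
    using orthant_strictly_monotonic_restrict_less[OF assms, of y]
    by (auto simp: restrict_vec_eq_self intro: less_imp_le)
qed simp

text \<open>If \<open>y\<close> vanished at a coordinate where \<open>x\<close> does not, dropping that coordinate from \<open>x\<close>
  would leave the pairing with \<open>y\<close> unchanged but strictly decrease \<open>N x\<close>.\<close>

lemma norming_vector_support:
  assumes N: "is_norm N" and mono: "orthant_strictly_monotonic N"
    and y: "dual_norm N y \<le> 1" "x \<bullet> y = N x" and "x $ i \<noteq> 0"
  shows "y $ i \<noteq> 0"
proof
  assume "y $ i = 0"
  then have "restrict_vec (- {i}) y = y"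
    by (auto simp: restrict_vec_eq_self)
  then have "N x = restrict_vec (- {i}) x \<bullet> y"
    using y(2) by (simp add: inner_restrict_vec)
  also have "\<dots> \<le> N (restrict_vec (- {i}) x) * dual_norm N y"
    by (rule inner_le_norm_dual_norm[OF N])
  also have "\<dots> \<le> N (restrict_vec (- {i}) x)"
    using y(1) is_normD(1)[OF N] by (simp add: mult_left_le)
  also have "\<dots> < N x"
    using \<open>x $ i \<noteq> 0\<close> by (intro orthant_strictly_monotonic_restrict_less[OF mono]) auto
  finally show False by simp
qed

section \<open>Generalized top-k and k-support dual norms\<close>

lemma dual_norm_restrict_le_top_k:
  fixes N :: "real ^ 'n \<Rightarrow> real"
  assumes "card K \<le> k"
  shows "dual_norm N (restrict_vec K y) \<le> top_k_dual_norm N k y"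
  unfolding top_k_dual_norm_def
  using assms by (intro cSUP_upper) auto

text \<open>The supremum ranges over finitely many sets of coordinates, so it is attained.\<close>

lemma top_k_dual_norm_attained:
  fixes N :: "real ^ 'n \<Rightarrow> real"
  obtains K where "card K \<le> k" and "top_k_dual_norm N k y = dual_norm N (restrict_vec K y)"
proof -
  let ?A = "(\<lambda>K. dual_norm N (restrict_vec K y)) ` {K. card K \<le> k}"
  have "finite ?A" "?A \<noteq> {}"
    using card.empty by (auto intro: exI[of _ "{}"])
  then have "Sup ?A \<in> ?A"
    by (simp add: cSup_eq_Max)
  with that show thesis
    unfolding top_k_dual_norm_def by auto
qed

lemma is_norm_top_k_dual_norm:
  fixes N :: "real ^ 'n \<Rightarrow> real"
  assumes N: "is_norm N" and "1 \<le> k"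
  shows "is_norm (top_k_dual_norm N k)"
proof -
  let ?M = "dual_norm N" and ?T = "top_k_dual_norm N k"
  note M = is_norm_dual_norm[OF N]
  have nonneg: "0 \<le> ?T y" for y
    using top_k_dual_norm_attained[of k N y] is_normD(1)[OF M] by metis
  have definite: "y = 0" if "?T y = 0" for y
  proof -
    have "y $ i = 0" for i
    proof -
      have "?M (restrict_vec {i} y) \<le> 0"
        using dual_norm_restrict_le_top_k[of "{i}" k N y] that \<open>1 \<le> k\<close> by simp
      then have "restrict_vec {i} y = 0"
        using is_normD(1,2)[OF M, of "restrict_vec {i} y"] by simp
      then show ?thesis
        by (auto simp: restrict_vec_def vec_eq_iff split: if_splits)
    qed
    then show ?thesis by (simp add: vec_eq_iff)
  qed
  have zero: "?T 0 = 0"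
    using top_k_dual_norm_attained[of k N 0] is_normD(5)[OF M] restrict_vec_eq_self[of _ 0]
    by (metis zero_index)
  have scale: "?T (c *\<^sub>R y) = \<bar>c\<bar> * ?T y" for c y
  proof (rule antisym)
    obtain K where "card K \<le> k" "?T (c *\<^sub>R y) = ?M (restrict_vec K (c *\<^sub>R y))"
      using top_k_dual_norm_attained .
    then show "?T (c *\<^sub>R y) \<le> \<bar>c\<bar> * ?T y"
      using dual_norm_restrict_le_top_k[of K k N y]
      by (simp add: restrict_vec_linear is_normD(3)[OF M] mult_left_mono)
    obtain K where "card K \<le> k" "?T y = ?M (restrict_vec K y)"
      using top_k_dual_norm_attained .
    then show "\<bar>c\<bar> * ?T y \<le> ?T (c *\<^sub>R y)"
      using dual_norm_restrict_le_top_k[of K k N "c *\<^sub>R y"]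
      by (simp add: restrict_vec_linear is_normD(3)[OF M])
  qed
  have triangle: "?T (y + z) \<le> ?T y + ?T z" for y z
  proof -
    obtain K where K: "card K \<le> k" "?T (y + z) = ?M (restrict_vec K (y + z))"
      using top_k_dual_norm_attained .
    show ?thesis
      using K is_normD(4)[OF M, of "restrict_vec K y" "restrict_vec K z"]
        dual_norm_restrict_le_top_k[OF K(1), of N y] dual_norm_restrict_le_top_k[OF K(1), of N z]
      by (simp add: restrict_vec_linear)
  qed
  show ?thesis
    unfolding is_norm_def using nonneg definite zero scale triangle by blast
qed

lemma k_support_dual_norm_nonneg:
  assumes "is_norm N" and "1 \<le> k"
  shows "0 \<le> k_support_dual_norm N k x"
  unfolding k_support_dual_norm_def
  by (rule dual_norm_nonneg[OF is_norm_top_k_dual_norm[OF assms]])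

lemma k_support_dual_norm_zero:
  assumes "is_norm N" and "1 \<le> k"
  shows "k_support_dual_norm N k 0 = 0"
  unfolding k_support_dual_norm_def
  by (rule dual_norm_zero[OF is_norm_top_k_dual_norm[OF assms]])

text \<open>Pairing with \<open>x\<close> only sees the restriction to the support of \<open>x\<close>, which is one of the
  sets of coordinates over which the top-\<open>l0 x\<close> norm is a supremum.\<close>

lemma k_support_dual_norm_sparse_le:
  assumes N: "is_norm N" and "x \<noteq> 0"
  shows "k_support_dual_norm N (l0 x) x \<le> N x"
proof -
  let ?K = "{i. x $ i \<noteq> 0}"
  have "1 \<le> l0 x"
    using \<open>x \<noteq> 0\<close> by (auto simp: l0_def Suc_le_eq card_gt_0_iff vec_eq_iff)
  show ?thesis
    unfolding k_support_dual_norm_def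
  proof (rule dual_norm_le[OF is_norm_top_k_dual_norm[OF N \<open>1 \<le> l0 x\<close>]])
    fix y assume y: "top_k_dual_norm N (l0 x) y \<le> 1"
    have "y \<bullet> x = x \<bullet> restrict_vec ?K y"
      using inner_restrict_vec[of ?K x y] restrict_vec_eq_self[of ?K x] by (simp add: inner_commute)
    also have "\<dots> \<le> N x * dual_norm N (restrict_vec ?K y)"
      by (rule inner_le_norm_dual_norm[OF N])
    also have "\<dots> \<le> N x"
      using dual_norm_restrict_le_top_k[of ?K "l0 x" N y] y is_normD(1)[OF N, of x]
      by (simp add: l0_def mult_left_le)
    finally show "y \<bullet> x \<le> N x" .
  qed
qed

section \<open>Feasible decompositions\<close>

text \<open>A vector \<open>y\<close> norming \<open>x\<close> has top-\<open>j\<close> norm at most \<open>1\<close>, and less than \<open>1\<close> for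
  \<open>j < l0 x\<close>, so the constraint leaves no room for mass at these indices.\<close>

lemma feasible_concentrated:
  fixes N :: "real ^ 'n \<Rightarrow> real"
  assumes N: "is_norm N"
    and mono: "orthant_strictly_monotonic N" "orthant_strictly_monotonic (dual_norm N)"
    and "x \<noteq> 0" and X: "feasible N x X"
  shows "(\<Sum>j=1..CARD('n). k_support_dual_norm N j (X j)) = N x"
    and "\<And>j. 1 \<le> j \<Longrightarrow> j < l0 x \<Longrightarrow> k_support_dual_norm N j (X j) = 0"
proof -
  let ?M = "dual_norm N" and ?T = "top_k_dual_norm N" and ?S = "k_support_dual_norm N"
  let ?I = "{1..CARD('n)}"
  obtain y where y: "?M y \<le> 1" "x \<bullet> y = N x"
    using ex_norming_vector[OF N \<open>x \<noteq> 0\<close>] .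
  have T_le: "?T j y \<le> 1" for j
    using top_k_dual_norm_attained[of j N y] orthant_strictly_monotonic_restrict_le[OF mono(2)] y(1)
    by (metis order_trans)
  have T_less: "?T j y < 1" if "j < l0 x" for j
  proof -
    obtain K where K: "card K \<le> j" "?T j y = ?M (restrict_vec K y)"
      using top_k_dual_norm_attained .
    then have "\<not> {i. x $ i \<noteq> 0} \<subseteq> K"
      using that card_mono[of K "{i. x $ i \<noteq> 0}"] by (auto simp: l0_def)
    then obtain i where i: "x $ i \<noteq> 0" "i \<notin> K"
      by auto
    then have "?M (restrict_vec K y) < ?M y"
      using norming_vector_support[OF N mono(1) y]
      by (intro orthant_strictly_monotonic_restrict_less[OF mono(2)]) auto
    with K y(1) show ?thesis by simp
  qed
  have S_nonneg: "0 \<le> ?S j (X j)" if "j \<in> ?I" for j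
    using that by (intro k_support_dual_norm_nonneg[OF N]) simp
  have TS_le: "?T j y * ?S j (X j) \<le> ?S j (X j)" if "j \<in> ?I" for j
    using mult_right_mono[OF T_le S_nonneg[OF that]] by simp
  have "N x = (\<Sum>j\<in>?I. y \<bullet> X j)"
    using X y(2) by (simp add: feasible_def inner_sum_right[symmetric] inner_commute)
  also have "\<dots> \<le> (\<Sum>j\<in>?I. ?T j y * ?S j (X j))"
    unfolding k_support_dual_norm_def
    by (intro sum_mono inner_le_norm_dual_norm is_norm_top_k_dual_norm[OF N]) simp
  finally have lower: "N x \<le> (\<Sum>j\<in>?I. ?T j y * ?S j (X j))" .
  have upper: "(\<Sum>j\<in>?I. ?S j (X j)) \<le> N x"
    using X by (simp add: feasible_def)
  show total: "(\<Sum>j\<in>?I. ?S j (X j)) = N x"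
  proof (rule antisym[OF upper])
    have "(\<Sum>j\<in>?I. ?T j y * ?S j (X j)) \<le> (\<Sum>j\<in>?I. ?S j (X j))"
      by (rule sum_mono[OF TS_le])
    with lower show "N x \<le> (\<Sum>j\<in>?I. ?S j (X j))" by linarith
  qed
  show "?S j (X j) = 0" if "1 \<le> j" "j < l0 x" for j
  proof -
    have "l0 x \<le> CARD('n)"
      unfolding l0_def by (rule card_mono) auto
    with that have j: "j \<in> ?I" by simp
    have "?T j y * ?S j (X j) = ?S j (X j)"
    proof (rule ccontr)
      assume "\<not> ?thesis"
      with TS_le[OF j] have "?T j y * ?S j (X j) < ?S j (X j)" by linarith
      then have "(\<Sum>j\<in>?I. ?T j y * ?S j (X j)) < (\<Sum>j\<in>?I. ?S j (X j))"
        using TS_le j by (intro sum_strict_mono_ex1) auto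
      with lower upper show False by simp
    qed
    with T_less[OF that(2)] show ?thesis by simp
  qed
qed

theorem theorem10:
  fixes N :: "real ^ 'n \<Rightarrow> real" and \<phi> :: "nat \<Rightarrow> real" and x :: "real ^ 'n"
  assumes "is_norm N"
    and "orthant_strictly_monotonic N"
    and "orthant_strictly_monotonic (dual_norm N)"
    and "\<forall>j\<in>{0..CARD('n)}. 0 \<le> \<phi> j"
    and "mono_on {0..CARD('n)} \<phi>"
    and "\<phi> 0 = 0"
    and "x \<noteq> 0"
  shows "\<phi> (l0 x) = (1 / N x) * (LEAST v. \<exists>X. feasible N x X \<and> v = objective N \<phi> X) \<and>
         (\<forall>l. l0 x = l \<and> l \<ge> 1 \<longrightarrow>
           is_arg_min (objective N \<phi>) (feasible N x) (\<lambda>j. if j = l then x else 0))"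
proof -
  let ?S = "k_support_dual_norm N" and ?I = "{1..CARD('n)}"
  let ?P = "\<lambda>j. if j = l0 x then x else 0"
  note N = \<open>is_norm N\<close>
  have l: "l0 x \<in> ?I"
    using \<open>x \<noteq> 0\<close> by (auto simp: l0_def Suc_le_eq card_gt_0_iff vec_eq_iff intro: card_mono)
  have S_P: "?S j (?P j) = (if j = l0 x then ?S (l0 x) x else 0)" if "j \<in> ?I" for j
    using that by (simp add: k_support_dual_norm_zero[OF N])
  have "(\<Sum>j\<in>?I. ?S j (?P j)) = ?S (l0 x) x"
    using l by (subst sum.cong[OF refl S_P]) auto
  moreover have "(\<Sum>j\<in>?I. ?P j) = x"
    using l by simp
  ultimately have P: "feasible N x ?P"
    using k_support_dual_norm_sparse_le[OF N \<open>x \<noteq> 0\<close>] by (simp add: feasible_def)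
  have lower: "\<phi> (l0 x) * N x \<le> objective N \<phi> X" if X: "feasible N x X" for X
  proof -
    note concentrated = feasible_concentrated[OF N assms(2,3) \<open>x \<noteq> 0\<close> X]
    have "\<phi> (l0 x) * ?S j (X j) \<le> \<phi> j * ?S j (X j)" if j: "j \<in> ?I" for j
    proof (cases "j < l0 x")
      case True
      with concentrated(2)[of j] j show ?thesis by simp
    next
      case False
      then have "\<phi> (l0 x) \<le> \<phi> j"
        using l j by (intro mono_onD[OF assms(5)]) auto
      then show ?thesis
        using j by (intro mult_right_mono k_support_dual_norm_nonneg[OF N]) auto
    qed
    then have "(\<Sum>j\<in>?I. \<phi> (l0 x) * ?S j (X j)) \<le> objective N \<phi> X"
      unfolding objective_def by (rule sum_mono)
    then show ?thesis
      unfolding sum_distrib_left[symmetric] concentrated(1) .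
  qed
  have "objective N \<phi> ?P = (\<Sum>j\<in>?I. if j = l0 x then \<phi> (l0 x) * ?S (l0 x) x else 0)"
    unfolding objective_def by (rule sum.cong) (auto simp: S_P)
  then have "objective N \<phi> ?P \<le> \<phi> (l0 x) * N x"
    using l k_support_dual_norm_sparse_le[OF N \<open>x \<noteq> 0\<close>] assms(4) by (simp add: mult_left_mono)
  with lower[OF P] have obj: "objective N \<phi> ?P = \<phi> (l0 x) * N x"
    by simp
  have "(LEAST v. \<exists>X. feasible N x X \<and> v = objective N \<phi> X) = \<phi> (l0 x) * N x"
    using P obj lower by (intro Least_equality) metis+
  moreover have "is_arg_min (objective N \<phi>) (feasible N x) ?P"
    unfolding is_arg_min_def using P obj lower by (auto simp: not_less)
  ultimately show ?thesis
    using is_norm_pos[OF N \<open>x \<noteq> 0\<close>] by auto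
qed

end
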